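(* Let $(X,G)$ be a transitive topological dynamical system and let $m\in\mathbb{N}$. Then $(X,G)$ is diam-mean $m$-sensitive if and only if there exists an essential weakly mean-sensitive $m$-tuple in $X^m$.
   Context: A topological dynamical system (tds) $(X,G)$ consists of a compact metric space $X$ with metric $d$ and a countably infinite discrete amenable group $G$ acting on $X$ by homeomorphisms; the action is written $x\mapsto gx$, and $gU=\{gx : x\in U\}$. The tds is transitive if some point has a dense orbit. $\mathbb{N}=\{1,2,\dots\}$. A Følner sequence is a sequence $\mathcal{F}=(\mathcal{F}_n)_{n\in\mathbb{N}}$ of nonempty finite subsets of $G$ with $\lim_{n\to\infty}|\mathcal{F}_n\triangle K\mathcal{F}_n|/|\mathcal{F}_n|=0$ for every nonempty finite $K\subseteq G$. The symbol $\sup_{\mathcal{F}}$ denotes the supremum over all Følner sequences of $G$. For $S\subseteq G$ let $\overline{\mathrm{BD}}(S)=\sup_{\mathcal{F}}\limsup_{n\to\infty}|S\cap\mathcal{F}_n|/|\mathcal{F}_n|$ (upper Banach density). For $x_1,\dots,x_m\in X$ let $D_m(x_1,\dots,x_m)=\min_{1\le i<j\le m}d(x_i,x_j)$, and for $A\subseteq X$ let $\mathrm{Diam}_m(A)=\sup\{D_m(x_1,\dots,x_m) : (x_1,\dots,x_m)\in A^m\}$. Convention: $\min\emptyset=+\infty$ (relevant only for $m=1$). $(X,G)$ is diam-mean $m$-sensitive if there is $\varepsilon>0$ such that $\sup_{\mathcal{F}}\limsup_{n\to\infty}\frac{1}{|\mathcal{F}_n|}\sum_{g\in\mathcal{F}_n}\mathrm{Diam}_m(gU)\ge\varepsilon$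 for every nonempty open $U\subseteq X$. A tuple $(x_1,\dots,x_m)\in X^m$ is a weakly mean-sensitive $m$-tuple if for all open neighbourhoods $U_k$ of $x_k$ ($1\le k\le m$) there is $\eta>0$ such that for every nonempty open $U\subseteq X$, $\overline{\mathrm{BD}}(\{g\in G : gU\cap U_k\ne\emptyset\text{ for }1\le k\le m\})>\eta$. It is essential if $x_i\ne x_j$ for all $i\ne j$. *)

theory Defs
  imports "HOL-Analysis.Analysis" "HOL-Algebra.Group_Action"
begin

definition folner_sequence :: "('g, 'r) monoid_scheme \<Rightarrow> (nat \<Rightarrow> 'g set) \<Rightarrow> bool"
  where "folner_sequence G F \<longleftrightarrow>
    (\<forall>n. finite (F n) \<and> F n \<noteq> {} \<and> F n \<subseteq> carrier G) \<and>
    (\<forall>K. finite K \<and> K \<noteq> {} \<and> K \<subseteq> carrier G \<longrightarrow>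
      (\<lambda>n. real (card (sym_diff (F n) (K <#>\<^bsub>G\<^esub> F n))) / real (card (F n))) \<longlonglongrightarrow> 0)"

text \<open>For countable discrete groups, amenability is the existence of a Foelner sequence.\<close>

definition amenable :: "('g, 'r) monoid_scheme \<Rightarrow> bool"
  where "amenable G \<longleftrightarrow> (\<exists>F. folner_sequence G F)"

text \<open>The space \<open>X\<close> is the whole type \<open>'x\<close>.\<close>

locale topological_dynamical_system = group_action G UNIV \<phi>
  for G :: "('g, 'r) monoid_scheme" (structure) and \<phi> :: "'g \<Rightarrow> 'x::metric_space \<Rightarrow> 'x" +
  assumes compact_space: "compact (UNIV :: 'x set)"
    and countable_group: "countable (carrier G)"
    and infinite_group: "infinite (carrier G)"
    and amenable_group: "amenable G"
    and homeomorphisms: "\<And>g. g \<in> carrier G \<Longrightarrow> homeomorphic_map euclidean euclidean (\<phi> g)"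

definition transitive_tds ::
    "('g, 'r) monoid_scheme \<Rightarrow> ('g \<Rightarrow> 'x::metric_space \<Rightarrow> 'x) \<Rightarrow> bool"
  where "transitive_tds G \<phi> \<longleftrightarrow> (\<exists>x. closure (orbit G \<phi> x) = UNIV)"

definition upper_banach_density :: "('g, 'r) monoid_scheme \<Rightarrow> 'g set \<Rightarrow> ennreal"
  where "upper_banach_density G S =
    (SUP F \<in> {F. folner_sequence G F}.
      limsup (\<lambda>n. of_nat (card (S \<inter> F n)) / of_nat (card (F n))))"

text \<open>An \<open>m\<close>-tuple is a function on \<open>nat\<close> of which only the values at \<open>1, \<dots>, m\<close> matter.
  Distances are taken in \<^typ>\<open>ennreal\<close>, where the infimum of the empty set is \<open>\<infinity>\<close>; hence
  \<open>min_dist 1 x = \<infinity>\<close>, and \<open>Diam 1 A = \<infinity>\<close> for every nonempty \<open>A\<close>.\<close>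

definition min_dist :: "nat \<Rightarrow> (nat \<Rightarrow> 'x::metric_space) \<Rightarrow> ennreal"
  where "min_dist m x = (INF (i, j) \<in> {(i, j). 1 \<le> i \<and> i < j \<and> j \<le> m}. ennreal (dist (x i) (x j)))"

definition Diam :: "nat \<Rightarrow> 'x::metric_space set \<Rightarrow> ennreal"
  where "Diam m A = (SUP x \<in> {1..m} \<rightarrow> A. min_dist m x)"

definition diam_mean_sensitive ::
    "('g, 'r) monoid_scheme \<Rightarrow> ('g \<Rightarrow> 'x::metric_space \<Rightarrow> 'x) \<Rightarrow> nat \<Rightarrow> bool"
  where "diam_mean_sensitive G \<phi> m \<longleftrightarrow>
    (\<exists>\<epsilon>::real. \<epsilon> > 0 \<and>
      (\<forall>U. open U \<and> U \<noteq> {} \<longrightarrow>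
        (SUP F \<in> {F. folner_sequence G F}.
          limsup (\<lambda>n. (\<Sum>g\<in>F n. Diam m (\<phi> g ` U)) / of_nat (card (F n)))) \<ge> ennreal \<epsilon>))"

definition weakly_mean_sensitive_tuple ::
    "('g, 'r) monoid_scheme \<Rightarrow> ('g \<Rightarrow> 'x::metric_space \<Rightarrow> 'x) \<Rightarrow> nat \<Rightarrow> (nat \<Rightarrow> 'x) \<Rightarrow> bool"
  where "weakly_mean_sensitive_tuple G \<phi> m x \<longleftrightarrow>
    (\<forall>V. (\<forall>k\<in>{1..m}. open (V k) \<and> x k \<in> V k) \<longrightarrow>
      (\<exists>\<eta>::real. \<eta> > 0 \<and>
        (\<forall>U. open U \<and> U \<noteq> {} \<longrightarrow>
          upper_banach_density G {g \<in> carrier G. \<forall>k\<in>{1..m}. \<phi> g ` U \<inter> V k \<noteq> {}} > ennreal \<eta>)))"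

definition essential_tuple :: "nat \<Rightarrow> (nat \<Rightarrow> 'x) \<Rightarrow> bool"
  where "essential_tuple m x \<longleftrightarrow> (\<forall>i\<in>{1..m}. \<forall>j\<in>{1..m}. i \<noteq> j \<longrightarrow> x i \<noteq> x j)"

end

theory Submission
  imports Defs
begin

text \<open>
  The values of \<open>Diam m\<close> and the hitting times \<open>{g. gU \<inter> V k \<noteq> {} for all k}\<close> are compared through
  one functional, the \<^emph>\<open>upper Foelner mean\<close> of a function \<open>G \<rightarrow> [0, \<infinity>]\<close>. It is monotone,
  subadditive, homogeneous and does not increase under right translations, because right translates
  of Foelner sequences are Foelner sequences; upper Banach density is the mean of an indicator.

  If \<open>x\<close> is an essential weakly mean-sensitive tuple, small balls \<open>V k\<close> around the \<open>x k\<close> are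
  at distance at least some \<open>\<delta> > 0\<close> from each other. Whenever \<open>gU\<close> meets all of them, the diameter
  of \<open>gU\<close> is at least \<open>\<delta>\<close>, so its mean is at least \<open>\<delta>\<close> times the density of these \<open>g\<close>.

  Conversely, let the system be diam-mean sensitive. As distances are bounded, there are \<open>a, c > 0\<close>
  such that for every \<open>U\<close> the set of \<open>g\<close> with \<open>Diam m (gU) > a\<close> has density at least \<open>c\<close>
  (\<open>diam_mean_sensitive_imp_large_diam_dense\<close>). For such \<open>g\<close> the set \<open>gU\<close> contains the entries
  of a tuple in the compact set \<open>K\<close> of tuples whose entries have pairwise distance at
  least \<open>a\<close>. If no tuple in \<open>K\<close> were weakly mean-sensitive, each would have a box
  neighbourhood that suitable open sets hit with arbitrarily small density. Finitely many, say \<open>N\<close>, of these boxes cover \<open>K\<close>;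
  choose open sets \<open>U j\<close> that hit the \<open>j\<close>-th box with density at most \<open>c / (2 (N + 1))\<close>. By
  transitivity one nonempty open set \<open>W\<close> is carried into all the \<open>U j\<close> by group elements
  (\<open>transitive_common_refinement\<close>), and by right invariance \<open>W\<close> hits every box as rarely as \<open>U j\<close>
  does. Hence \<open>gW\<close> has large diameter only for a set of \<open>g\<close> of density less than \<open>c\<close>,
  a contradiction.
\<close>

section \<open>The upper Foelner mean\<close>

definition upper_folner_mean :: "('g, 'r) monoid_scheme \<Rightarrow> ('g \<Rightarrow> ennreal) \<Rightarrow> ennreal"
  where "upper_folner_mean G f =
    (SUP F \<in> {F. folner_sequence G F}. limsup (\<lambda>n. (\<Sum>g\<in>F n. f g) / of_nat (card (F n))))"

lemma folner_sequenceD: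
  assumes "folner_sequence G F"
  shows "finite (F n)" "F n \<noteq> {}" "F n \<subseteq> carrier G" "card (F n) > 0"
  using assms by (auto simp: folner_sequence_def card_gt_0_iff)

lemma upper_banach_density_eq_mean:
  "upper_banach_density G S = upper_folner_mean G (indicator S)"
  unfolding upper_banach_density_def upper_folner_mean_def
proof (rule SUP_cong, simp)
  fix F assume "F \<in> {F. folner_sequence G F}"
  then have "finite (F n)" for n by (auto dest: folner_sequenceD)
  then have "(\<Sum>g\<in>F n. indicator S g) = (of_nat (card (S \<inter> F n)) :: ennreal)" for n
    by (simp add: indicator_def sum.If_cases Int_commute)
  then show "limsup (\<lambda>n. of_nat (card (S \<inter> F n)) / of_nat (card (F n))) =
      limsup (\<lambda>n. (\<Sum>g\<in>F n. indicator S g) / of_nat (card (F n)) :: ennreal)"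
    by simp
qed

lemma upper_folner_mean_mono:
  assumes "\<And>g. g \<in> carrier G \<Longrightarrow> f g \<le> h g"
  shows "upper_folner_mean G f \<le> upper_folner_mean G h"
  unfolding upper_folner_mean_def
proof (intro SUP_subset_mono subset_refl Limsup_mono always_eventually allI divide_right_mono_ennreal sum_mono)
  fix F n g assume "F \<in> {F. folner_sequence G F}" "g \<in> F n"
  then show "f g \<le> h g" using assms folner_sequenceD(3) by blast
qed

lemma upper_folner_mean_const_le: "upper_folner_mean G (\<lambda>_. c) \<le> c"
  unfolding upper_folner_mean_def
proof (intro SUP_least Limsup_bounded always_eventually allI)
  fix F n assume "F \<in> {F. folner_sequence G F}"
  then have "card (F n) > 0" by (auto dest: folner_sequenceD)
  then show "(\<Sum>g\<in>F n. c) / of_nat (card (F n)) \<le> c"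
    by (simp add: mult_divide_eq_ennreal mult.commute[of _ c])
qed

lemma amenable_imp_density_carrier_ge_1:
  assumes "amenable G"
  shows "1 \<le> upper_banach_density G (carrier G)"
proof -
  obtain F where F: "folner_sequence G F" using assms by (auto simp: amenable_def)
  have "of_nat (card (carrier G \<inter> F n)) / of_nat (card (F n)) = (1 :: ennreal)" for n
    using folner_sequenceD[OF F, of n]
    by (simp add: Int_absorb1 ennreal_divide_self ennreal_of_nat_eq_real_of_nat)
  then have "limsup (\<lambda>n. of_nat (card (carrier G \<inter> F n)) / of_nat (card (F n)) :: ennreal) = 1"
    by (simp add: Limsup_const)
  then show ?thesis
    unfolding upper_banach_density_def using F by (intro SUP_upper2[of F]) auto
qed

lemma limsup_add_le_ennreal:
  fixes u v :: "nat \<Rightarrow> ennreal"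
  shows "limsup (\<lambda>n. u n + v n) \<le> limsup u + limsup v"
  including ennreal.lifting
  by transfer (rule ereal_limsup_add_mono)

lemma upper_folner_mean_add:
  "upper_folner_mean G (\<lambda>g. f g + h g) \<le> upper_folner_mean G f + upper_folner_mean G h"
  unfolding upper_folner_mean_def
proof (rule SUP_least)
  fix F assume F: "F \<in> {F. folner_sequence G F}"
  have "limsup (\<lambda>n. (\<Sum>g\<in>F n. f g + h g) / of_nat (card (F n))) \<le>
      limsup (\<lambda>n. (\<Sum>g\<in>F n. f g) / of_nat (card (F n)))
      + limsup (\<lambda>n. (\<Sum>g\<in>F n. h g) / of_nat (card (F n)))"
    using limsup_add_le_ennreal by (simp add: sum.distrib add_divide_distrib_ennreal)
  also have "\<dots> \<le> (SUP F \<in> {F. folner_sequence G F}. limsup (\<lambda>n. (\<Sum>g\<in>F n. f g) / of_nat (card (F n))))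
      + (SUP F \<in> {F. folner_sequence G F}. limsup (\<lambda>n. (\<Sum>g\<in>F n. h g) / of_nat (card (F n))))"
    by (intro add_mono SUP_upper F)
  finally show "limsup (\<lambda>n. (\<Sum>g\<in>F n. f g + h g) / of_nat (card (F n))) \<le> \<dots>" .
qed

lemma upper_folner_mean_cmult:
  assumes "c < \<infinity>"
  shows "upper_folner_mean G (\<lambda>g. c * f g) = c * upper_folner_mean G f"
proof -
  have "limsup (\<lambda>n. (\<Sum>g\<in>F n. c * f g) / of_nat (card (F n))) =
      c * limsup (\<lambda>n. (\<Sum>g\<in>F n. f g) / of_nat (card (F n)))" for F :: "nat \<Rightarrow> _ set"
  proof -
    have "continuous_on UNIV (\<lambda>y. c * y)"
      using assms by (intro ennreal_continuous_on_cmult continuous_on_id) auto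
    then have "limsup (\<lambda>n. c * ((\<Sum>g\<in>F n. f g) / of_nat (card (F n)))) =
        c * limsup (\<lambda>n. (\<Sum>g\<in>F n. f g) / of_nat (card (F n)))"
      by (rule Limsup_compose_continuous_mono) (auto intro!: monoI mult_left_mono)
    then show ?thesis
      by (simp only: ennreal_times_divide sum_distrib_left)
  qed
  then show ?thesis
    unfolding upper_folner_mean_def by (simp add: SUP_mult_left_ennreal)
qed

lemma upper_folner_mean_sum:
  assumes "finite J"
  shows "upper_folner_mean G (\<lambda>g. \<Sum>j\<in>J. f j g) \<le> (\<Sum>j\<in>J. upper_folner_mean G (f j))"
  using assms
proof (induction J)
  case empty
  show ?case using upper_folner_mean_const_le[of G 0] by simp
next
  case (insert i J)
  have "upper_folner_mean G (\<lambda>g. f i g + (\<Sum>j\<in>J. f j g)) \<le>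
      upper_folner_mean G (f i) + upper_folner_mean G (\<lambda>g. \<Sum>j\<in>J. f j g)"
    by (rule upper_folner_mean_add)
  also have "\<dots> \<le> upper_folner_mean G (f i) + (\<Sum>j\<in>J. upper_folner_mean G (f j))"
    by (intro add_left_mono insert.IH)
  finally show ?case using insert.hyps by simp
qed

lemma (in group) card_r_coset:
  assumes "A \<subseteq> carrier G" "h \<in> carrier G"
  shows "card (A #> h) = card A"
proof -
  have "A #> h = (\<lambda>y. y \<otimes> h) ` A" by (auto simp: r_coset_def)
  then show ?thesis using inj_on_g[OF assms] by (simp add: card_image)
qed

text \<open>The Foelner condition concerns left translates \<open>K F\<close>, which commute with
  right translation.\<close>

lemma (in group) folner_sequence_r_coset:
  assumes "folner_sequence G F" and h: "h \<in> carrier G"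
  shows "folner_sequence G (\<lambda>n. F n #> h)"
proof -
  note F = folner_sequenceD[OF assms(1)]
  have img: "A #> h = (\<lambda>y. y \<otimes> h) ` A" for A by (auto simp: r_coset_def)
  have "card (sym_diff (F n #> h) (K <#> (F n #> h))) = card (sym_diff (F n) (K <#> F n))"
    if K: "K \<subseteq> carrier G" for K n
  proof -
    have KF: "K <#> F n \<subseteq> carrier G" using K F(3) by (rule set_mult_closed)
    have "K <#> (F n #> h) = (K <#> F n) #> h"
      using K F(3) h by (rule setmult_rcos_assoc)
    moreover have "sym_diff (F n #> h) ((K <#> F n) #> h) = sym_diff (F n) (K <#> F n) #> h"
      unfolding img image_Un
      using inj_on_image_set_diff[OF inj_on_g[OF subset_refl h]] F(3)[of n] KF
      by blast
    ultimately show ?thesis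
      using F(3)[of n] KF h by (simp only:) (rule card_r_coset, auto)
  qed
  moreover have "finite (F n #> h)" "F n #> h \<noteq> {}" "F n #> h \<subseteq> carrier G" for n
    using F[of n] r_coset_subset_G[OF F(3) h] unfolding img by auto
  ultimately show ?thesis
    using assms(1) F(3) h by (simp add: folner_sequence_def card_r_coset)
qed

lemma (in group) upper_folner_mean_translate_le:
  assumes h: "h \<in> carrier G"
  shows "upper_folner_mean G (\<lambda>g. f (g \<otimes> h)) \<le> upper_folner_mean G f"
  unfolding upper_folner_mean_def
proof (rule SUP_least)
  fix F assume "F \<in> {F. folner_sequence G F}"
  then have F: "folner_sequence G F" by simp
  have "(\<Sum>g\<in>F n. f (g \<otimes> h)) = (\<Sum>g\<in>F n #> h. f g)" for n
  proof -
    have "F n #> h = (\<lambda>y. y \<otimes> h) ` F n" by (auto simp: r_coset_def)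
    then show ?thesis
      using sum.reindex[OF inj_on_g[OF folner_sequenceD(3)[OF F] h], of f n] by (simp add: o_def)
  qed
  then have "limsup (\<lambda>n. (\<Sum>g\<in>F n. f (g \<otimes> h)) / of_nat (card (F n))) =
      limsup (\<lambda>n. (\<Sum>g\<in>F n #> h. f g) / of_nat (card (F n #> h)))"
    using card_r_coset[OF folner_sequenceD(3)[OF F] h] by simp
  also have "\<dots> \<le> (SUP F \<in> {F. folner_sequence G F}.
      limsup (\<lambda>n. (\<Sum>g\<in>F n. f g) / of_nat (card (F n))))"
    using folner_sequence_r_coset[OF F h] by (intro SUP_upper) simp
  finally show "limsup (\<lambda>n. (\<Sum>g\<in>F n. f (g \<otimes> h)) / of_nat (card (F n))) \<le> \<dots>" .
qed

lemma diam_mean_sensitive_iff_mean: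
  "diam_mean_sensitive G \<phi> m \<longleftrightarrow>
    (\<exists>\<epsilon>::real. \<epsilon> > 0 \<and> (\<forall>U. open U \<and> U \<noteq> {} \<longrightarrow>
      upper_folner_mean G (\<lambda>g. Diam m (\<phi> g ` U)) \<ge> ennreal \<epsilon>))"
  unfolding diam_mean_sensitive_def upper_folner_mean_def ..

section \<open>Separated tuples\<close>

definition separated_tuples :: "nat \<Rightarrow> real \<Rightarrow> (nat \<Rightarrow> 'x::metric_space) set"
  where "separated_tuples m a = {y. \<forall>i j. 1 \<le> i \<and> i < j \<and> j \<le> m \<longrightarrow> a \<le> dist (y i) (y j)}"

lemma separated_tuples_iff_min_dist:
  "y \<in> separated_tuples m a \<longleftrightarrow> ennreal a \<le> min_dist m y"
  by (auto simp: separated_tuples_def min_dist_def le_INF_iff ennreal_le_iff)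

lemma essential_tuple_if_separated:
  assumes "y \<in> separated_tuples m a" "a > 0"
  shows "essential_tuple m y"
proof -
  have "y i \<noteq> y j" if "1 \<le> i" "i < j" "j \<le> m" for i j
    using assms that unfolding separated_tuples_def by fastforce
  then show ?thesis
    unfolding essential_tuple_def by (metis atLeastAtMost_iff nat_neq_iff)
qed

lemma essential_tuple_separated:
  assumes "essential_tuple m x"
  obtains a where "a > 0" "x \<in> separated_tuples m a"
proof -
  define P where "P = {(i, j). 1 \<le> i \<and> i < j \<and> j \<le> m}"
  define a where "a = Min (insert 1 ((\<lambda>(i, j). dist (x i) (x j)) ` P))"
  have "P \<subseteq> {1..m} \<times> {1..m}" by (auto simp: P_def)
  then have fin: "finite P" by (rule finite_subset) simp
  have "a > 0"
    using assms fin unfolding a_def by (auto simp: P_def essential_tuple_def)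
  moreover have "a \<le> dist (x i) (x j)" if "(i, j) \<in> P" for i j
    using fin that unfolding a_def by (intro Min_le) force+
  ultimately show ?thesis
    by (intro that[of a]) (auto simp: separated_tuples_def P_def)
qed

text \<open>Tychonoff's theorem applies because tuples are functions on all of \<open>nat\<close>, with the product
  topology.\<close>

lemma compact_separated_tuples:
  assumes "compact (UNIV :: 'x::metric_space set)"
  shows "compact (separated_tuples m a :: (nat \<Rightarrow> 'x) set)"
proof -
  have "compact_space (euclidean :: 'x topology)"
    using assms by (simp add: compact_space_def)
  then have "compact_space (euclidean :: (nat \<Rightarrow> 'x) topology)"
    by (simp add: compact_space_product_topology flip: euclidean_product_topology)
  then have "compact (UNIV :: (nat \<Rightarrow> 'x) set)"
    by (simp add: compact_space_def)
  moreover have "closed (separated_tuples m a :: (nat \<Rightarrow> 'x) set)"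
    unfolding separated_tuples_def
    by (intro closed_Collect_all closed_Collect_imp closed_Collect_le open_Collect_const
        continuous_intros continuous_on_product_coordinates)
  ultimately show ?thesis
    using compact_Int_closed by fastforce
qed

lemma open_box:
  assumes "finite I" "\<And>k. k \<in> I \<Longrightarrow> open (V k)"
  shows "open {y :: 'i \<Rightarrow> 'x::topological_space. \<forall>k\<in>I. y k \<in> V k}"
proof -
  have "{y. \<forall>k\<in>I. y k \<in> V k} = (\<Inter>k\<in>I. (\<lambda>y. y k) -` V k)" by auto
  moreover have "open ((\<lambda>y :: 'i \<Rightarrow> 'x. y k) -` V k)" if "k \<in> I" for k
    using assms that by (intro open_vimage continuous_on_product_coordinates) auto
  ultimately show ?thesis using assms(1) by (simp add: open_INT)
qed

lemma Diam_ge_if_separated: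
  assumes "y \<in> {1..m} \<rightarrow> A" "y \<in> separated_tuples m a"
  shows "ennreal a \<le> Diam m A"
  using assms unfolding Diam_def separated_tuples_iff_min_dist by (blast intro: SUP_upper2)

lemma Diam_gt_imp_separated:
  assumes "Diam m A > ennreal a"
  obtains y where "y \<in> {1..m} \<rightarrow> A" "y \<in> separated_tuples m a"
  using assms unfolding Diam_def less_SUP_iff separated_tuples_iff_min_dist
  by (auto intro: less_imp_le)

lemma Diam_bounded:
  assumes "compact (UNIV :: 'x::metric_space set)" "m \<ge> 2"
  obtains D where "D > 0" "\<And>A :: 'x set. Diam m A \<le> ennreal D"
proof -
  obtain D where D: "dist x y \<le> D" for x y :: 'x
    using compact_imp_bounded[OF assms(1)] by (auto simp: bounded_two_points)
  have "min_dist m y \<le> ennreal (max 1 D)" for y :: "nat \<Rightarrow> 'x"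
    unfolding min_dist_def
    using assms(2) D[of "y 1" "y 2"] by (intro INF_lower2[of "(1, 2)"]) (auto intro: ennreal_leI)
  then have "Diam m A \<le> ennreal (max 1 D)" for A :: "'x set"
    unfolding Diam_def by (intro SUP_least)
  then show ?thesis by (intro that[of "max 1 D"]) auto
qed

lemma Diam_1:
  assumes "A \<noteq> {}"
  shows "Diam 1 A = \<infinity>"
proof -
  obtain p where "p \<in> A" using assms by auto
  moreover have "{(i, j). 1 \<le> i \<and> i < j \<and> j \<le> (1::nat)} = {}" by auto
  then have "min_dist 1 (\<lambda>_. p) = \<infinity>" by (simp add: min_dist_def)
  ultimately have "\<infinity> \<le> Diam 1 A" unfolding Diam_def by (intro SUP_upper2[of "\<lambda>_. p"]) auto
  then show ?thesis by (simp add: top_unique)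
qed

section \<open>Hitting times and sensitivity\<close>

definition hitting_times ::
    "('g, 'r) monoid_scheme \<Rightarrow> ('g \<Rightarrow> 'x \<Rightarrow> 'x) \<Rightarrow> nat \<Rightarrow> 'x set \<Rightarrow> (nat \<Rightarrow> 'x set) \<Rightarrow> 'g set"
  where "hitting_times G \<phi> m U V = {g \<in> carrier G. \<forall>k\<in>{1..m}. \<phi> g ` U \<inter> V k \<noteq> {}}"

text \<open>By the triangle inequality, balls of radius \<open>a / 3\<close> around points at distance at least \<open>a\<close>
  contain only points at distance at least \<open>a / 3\<close> from each other; so each \<open>g\<close> for which \<open>gU\<close>
  meets all the balls contributes at least \<open>a / 3\<close> to the mean diameter.\<close>

lemma diam_mean_sensitive_if_essential_tuple:
  assumes "essential_tuple m x" and wms: "weakly_mean_sensitive_tuple G \<phi> m x"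
  shows "diam_mean_sensitive G \<phi> m"
proof -
  obtain a where a: "a > 0" "x \<in> separated_tuples m a"
    using assms(1) by (rule essential_tuple_separated)
  define V where "V k = ball (x k) (a / 3)" for k
  have "\<forall>k\<in>{1..m}. open (V k) \<and> x k \<in> V k" using a by (simp add: V_def)
  then obtain \<eta> where \<eta>: "\<eta> > 0" and
    dens: "\<And>U. open U \<Longrightarrow> U \<noteq> {} \<Longrightarrow> upper_banach_density G (hitting_times G \<phi> m U V) > ennreal \<eta>"
    using wms unfolding weakly_mean_sensitive_tuple_def hitting_times_def by meson
  have "ennreal (a / 3 * \<eta>) \<le> upper_folner_mean G (\<lambda>g. Diam m (\<phi> g ` U))"
    if U: "open U" "U \<noteq> {}" for U
  proof -
    have "ennreal (a / 3) * indicator (hitting_times G \<phi> m U V) g \<le> Diam m (\<phi> g ` U)" for g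
    proof (cases "g \<in> hitting_times G \<phi> m U V")
      case True
      then have "\<forall>k\<in>{1..m}. \<exists>p. p \<in> \<phi> g ` U \<inter> V k" unfolding hitting_times_def by blast
      then obtain y where y: "\<And>k. k \<in> {1..m} \<Longrightarrow> y k \<in> \<phi> g ` U \<inter> V k" by metis
      have "a / 3 \<le> dist (y i) (y j)" if "1 \<le> i" "i < j" "j \<le> m" for i j
      proof -
        have "dist (x i) (y i) < a / 3" "dist (x j) (y j) < a / 3"
          using y[of i] y[of j] that by (auto simp: V_def)
        moreover have "a \<le> dist (x i) (x j)" using a(2) that by (auto simp: separated_tuples_def)
        ultimately show ?thesis
          using dist_triangle[of "x i" "x j" "y i"] dist_triangle[of "y i" "x j" "y j"]
          by (simp add: dist_commute)
      qed
      then have "y \<in> separated_tuples m (a / 3)" by (simp add: separated_tuples_def)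
      then show ?thesis
        using Diam_ge_if_separated[of y m "\<phi> g ` U"] y True by auto
    qed simp
    then have "ennreal (a / 3) * upper_banach_density G (hitting_times G \<phi> m U V)
        \<le> upper_folner_mean G (\<lambda>g. Diam m (\<phi> g ` U))"
      unfolding upper_banach_density_eq_mean
      by (subst upper_folner_mean_cmult[symmetric]) (auto intro: upper_folner_mean_mono)
    moreover have "ennreal (a / 3 * \<eta>) = ennreal (a / 3) * ennreal \<eta>"
      using a \<eta> by (intro ennreal_mult) auto
    moreover have "ennreal (a / 3) * ennreal \<eta> \<le>
        ennreal (a / 3) * upper_banach_density G (hitting_times G \<phi> m U V)"
      using dens[OF U] by (intro mult_left_mono) auto
    ultimately show ?thesis by simp
  qed
  then show ?thesis
    unfolding diam_mean_sensitive_iff_mean using a \<eta> by (intro exI[of _ "a / 3 * \<eta>"]) auto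
qed

text \<open>A quantity bounded by \<open>D\<close> with mean at least \<open>\<epsilon>\<close> exceeds \<open>\<epsilon> / 2\<close> with density at least
  \<open>\<epsilon> / (2 D)\<close>. For \<open>m = 1\<close> no such bound exists, but there \<open>Diam\<close> is infinite for every \<open>g\<close>.\<close>

lemma (in topological_dynamical_system) diam_mean_sensitive_imp_large_diam_dense:
  assumes "diam_mean_sensitive G \<phi> m" "m \<ge> 1"
  obtains a c :: real where "a > 0" "c > 0"
    "\<And>U. open U \<Longrightarrow> U \<noteq> {} \<Longrightarrow>
      ennreal c \<le> upper_banach_density G {g \<in> carrier G. Diam m (\<phi> g ` U) > ennreal a}"
proof (cases "m = 1")
  case True
  have "{g \<in> carrier G. Diam m (\<phi> g ` U) > ennreal 1} = carrier G" if "U \<noteq> {}" for U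
    using True that by (simp add: Diam_1 del: One_nat_def)
  then show ?thesis
    using amenable_imp_density_carrier_ge_1[OF amenable_group] by (intro that[of 1 1]) auto
next
  case False
  then obtain D where D: "D > 0" "\<And>A :: 'x set. Diam m A \<le> ennreal D"
    using Diam_bounded[OF compact_space, of m] assms(2) by auto
  obtain \<epsilon> where \<epsilon>: "\<epsilon> > 0" and
    mean: "\<And>U. open U \<Longrightarrow> U \<noteq> {} \<Longrightarrow> ennreal \<epsilon> \<le> upper_folner_mean G (\<lambda>g. Diam m (\<phi> g ` U))"
    using assms(1) unfolding diam_mean_sensitive_iff_mean by blast
  have "ennreal (\<epsilon> / (2 * D)) \<le>
      upper_banach_density G {g \<in> carrier G. Diam m (\<phi> g ` U) > ennreal (\<epsilon> / 2)}"
    if U: "open U" "U \<noteq> {}" for U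
  proof (rule ccontr)
    define S where "S = {g \<in> carrier G. Diam m (\<phi> g ` U) > ennreal (\<epsilon> / 2)}"
    assume "\<not> ?thesis"
    then have "upper_banach_density G S < ennreal (\<epsilon> / (2 * D))" by (simp add: S_def not_le)
    then obtain b where b: "upper_banach_density G S = ennreal b" "0 \<le> b" "b < \<epsilon> / (2 * D)"
      by (cases "upper_banach_density G S") (auto simp: ennreal_less_iff)
    have "ennreal \<epsilon> \<le> upper_folner_mean G (\<lambda>g. ennreal (\<epsilon> / 2) + ennreal D * indicator S g)"
    proof (rule order_trans[OF mean[OF U] upper_folner_mean_mono])
      fix g assume "g \<in> carrier G"
      then show "Diam m (\<phi> g ` U) \<le> ennreal (\<epsilon> / 2) + ennreal D * indicator S g"
        using D(2)[of "\<phi> g ` U"] by (cases "g \<in> S") (auto simp: S_def not_less add_increasing)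
    qed
    also have "\<dots> \<le> ennreal (\<epsilon> / 2) + ennreal D * upper_banach_density G S"
      unfolding upper_banach_density_eq_mean
      by (rule order_trans[OF upper_folner_mean_add])
        (auto intro!: add_mono upper_folner_mean_const_le simp: upper_folner_mean_cmult)
    also have "\<dots> = ennreal (\<epsilon> / 2 + D * b)"
      using \<epsilon> D b by (simp add: ennreal_mult ennreal_plus)
    also have "\<dots> < ennreal \<epsilon>"
      using \<epsilon> D b by (intro ennreal_lessI) (auto simp: field_simps)
    finally show False by simp
  qed
  then show ?thesis using \<epsilon> D(1) by (intro that[of "\<epsilon> / 2" "\<epsilon> / (2 * D)"]) auto
qed

text \<open>The dense orbit enters every \<open>U j\<close>, say at \<open>\<phi> (h j) x\<close>, so \<open>x\<close> lies in the open
  set of all points that each \<open>h j\<close> sends into \<open>U j\<close>.\<close>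

lemma (in topological_dynamical_system) transitive_common_refinement:
  assumes "transitive_tds G \<phi>" "finite J" "\<And>j. j \<in> J \<Longrightarrow> open (U j) \<and> U j \<noteq> {}"
  obtains W h where "open W" "W \<noteq> {}"
    "\<And>j. j \<in> J \<Longrightarrow> h j \<in> carrier G \<and> \<phi> (h j) ` W \<subseteq> U j"
proof -
  obtain x where x: "closure (orbit G \<phi> x) = UNIV"
    using assms(1) by (auto simp: transitive_tds_def)
  have "\<exists>h. h \<in> carrier G \<and> \<phi> h x \<in> U j" if "j \<in> J" for j
  proof -
    have "U j \<inter> orbit G \<phi> x \<noteq> {}"
      using open_Int_closure_eq_empty[of "U j" "orbit G \<phi> x"] assms(3)[OF that] x by auto
    then show ?thesis by (auto simp: orbit_def)
  qed
  then obtain h where h: "\<And>j. j \<in> J \<Longrightarrow> h j \<in> carrier G \<and> \<phi> (h j) x \<in> U j" by metis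
  define W where "W = (\<Inter>j\<in>J. \<phi> (h j) -` U j)"
  have "continuous_on UNIV (\<phi> (h j))" if "j \<in> J" for j
    using homeomorphic_imp_continuous_map[OF homeomorphisms] h[OF that] by simp
  then have "open W"
    unfolding W_def using assms(2,3) by (intro open_INT ballI open_vimage) auto
  moreover have "x \<in> W" using h by (simp add: W_def)
  ultimately show ?thesis using h by (intro that[of W h]) (auto simp: W_def)
qed

text \<open>From \<open>gW = (g h\<^sup>-\<^sup>1)(hW) \<subseteq> (g h\<^sup>-\<^sup>1)U\<close>, every hitting time of \<open>W\<close> is a hitting time of
  \<open>U\<close> translated on the right by \<open>h\<close>, and right translation does not change densities.\<close>

lemma (in topological_dynamical_system) density_hitting_times_le:
  assumes h: "h \<in> carrier G" and sub: "\<phi> h ` W \<subseteq> U"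
  shows "upper_banach_density G (hitting_times G \<phi> m W V) \<le>
    upper_banach_density G (hitting_times G \<phi> m U V)"
proof -
  interpret group G using group_hom group_hom.axioms(1) by auto
  have "g \<otimes> inv h \<in> hitting_times G \<phi> m U V" if g: "g \<in> hitting_times G \<phi> m W V" for g
  proof -
    have gG: "g \<in> carrier G" using g by (simp add: hitting_times_def)
    have "\<phi> g w = \<phi> (g \<otimes> inv h) (\<phi> h w)" for w
      using composition_rule[of w "g \<otimes> inv h" h] gG h by (simp add: m_assoc)
    then have "\<phi> g ` W = \<phi> (g \<otimes> inv h) ` \<phi> h ` W" by (simp add: image_image)
    then have "\<phi> g ` W \<subseteq> \<phi> (g \<otimes> inv h) ` U" using sub by auto
    then show ?thesis using g gG h by (fastforce simp: hitting_times_def)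
  qed
  then have "upper_banach_density G (hitting_times G \<phi> m W V) \<le>
      upper_folner_mean G (\<lambda>g. indicator (hitting_times G \<phi> m U V) (g \<otimes> inv h))"
    unfolding upper_banach_density_eq_mean
    by (intro upper_folner_mean_mono) (auto simp: indicator_def)
  also have "\<dots> \<le> upper_banach_density G (hitting_times G \<phi> m U V)"
    unfolding upper_banach_density_eq_mean using h by (intro upper_folner_mean_translate_le) simp
  finally show ?thesis .
qed

text \<open>Covering the compact set of separated tuples by boxes around tuples that are not weakly
  mean-sensitive makes large diameters rarer than sensitivity permits.\<close>

lemma (in topological_dynamical_system) essential_tuple_if_diam_mean_sensitive:
  assumes trans: "transitive_tds G \<phi>" and "diam_mean_sensitive G \<phi> m" "m \<ge> 1"
  shows "\<exists>x. essential_tuple m x \<and> weakly_mean_sensitive_tuple G \<phi> m x"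
proof (rule ccontr)
  assume no_tuple: "\<not> ?thesis"
  obtain a c :: real where ac: "a > 0" "c > 0" and large:
    "\<And>U. open U \<Longrightarrow> U \<noteq> {} \<Longrightarrow>
      ennreal c \<le> upper_banach_density G {g \<in> carrier G. Diam m (\<phi> g ` U) > ennreal a}"
    using diam_mean_sensitive_imp_large_diam_dense[OF assms(2,3)] by blast
  define K where "K = (separated_tuples m a :: (nat \<Rightarrow> 'x) set)"
  have "\<exists>V. (\<forall>k\<in>{1..m}. open (V k) \<and> y k \<in> V k) \<and>
      (\<forall>\<eta>>0. \<exists>U. open U \<and> U \<noteq> {} \<and>
        upper_banach_density G (hitting_times G \<phi> m U V) \<le> ennreal \<eta>)" if "y \<in> K" for y
  proof -
    have "\<not> weakly_mean_sensitive_tuple G \<phi> m y"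
      using no_tuple that essential_tuple_if_separated[of y m a] ac unfolding K_def by blast
    then obtain V where V: "\<forall>k\<in>{1..m}. open (V k) \<and> y k \<in> V k" and
      not_dense: "\<not> (\<exists>\<eta>::real. \<eta> > 0 \<and> (\<forall>U. open U \<and> U \<noteq> {} \<longrightarrow>
        upper_banach_density G (hitting_times G \<phi> m U V) > ennreal \<eta>))"
      unfolding weakly_mean_sensitive_tuple_def hitting_times_def by blast
    have "\<exists>U. open U \<and> U \<noteq> {} \<and>
        upper_banach_density G (hitting_times G \<phi> m U V) \<le> ennreal \<eta>" if "\<eta> > 0" for \<eta>
      using not_dense that by (meson not_less)
    then show ?thesis using V by blast
  qed
  then have "\<forall>y\<in>K. \<exists>V. (\<forall>k\<in>{1..m}. open (V k) \<and> y k \<in> V k) \<and>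
      (\<forall>\<eta>>0. \<exists>U. open U \<and> U \<noteq> {} \<and>
        upper_banach_density G (hitting_times G \<phi> m U V) \<le> ennreal \<eta>)" by blast
  from bchoice[OF this] obtain V where
    V: "\<And>y k. y \<in> K \<Longrightarrow> k \<in> {1..m} \<Longrightarrow> open (V y k) \<and> y k \<in> V y k" and
    rare: "\<And>y \<eta>. y \<in> K \<Longrightarrow> \<eta> > 0 \<Longrightarrow> \<exists>U. open U \<and> U \<noteq> {} \<and>
        upper_banach_density G (hitting_times G \<phi> m U (V y)) \<le> ennreal \<eta>"
    by blast
  define B where "B y = {z. \<forall>k\<in>{1..m}. z k \<in> V y k}" for y
  have "compact K" unfolding K_def using compact_space by (rule compact_separated_tuples)
  moreover have "open (B y)" if "y \<in> K" for y
    unfolding B_def using V[OF that] by (intro open_box) auto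
  moreover have "K \<subseteq> (\<Union>y\<in>K. B y)" using V by (auto simp: B_def)
  ultimately obtain J where J: "J \<subseteq> K" "finite J" "K \<subseteq> (\<Union>y\<in>J. B y)"
    by (rule compactE_image)
  \<comment> \<open>The summand \<open>1\<close> keeps \<open>\<eta>\<close> positive when \<open>J\<close> is empty.\<close>
  define \<eta> where "\<eta> = c / (2 * (real (card J) + 1))"
  have \<eta>: "\<eta> > 0" using ac by (simp add: \<eta>_def)
  then have "\<forall>y\<in>J. \<exists>U. open U \<and> U \<noteq> {} \<and>
      upper_banach_density G (hitting_times G \<phi> m U (V y)) \<le> ennreal \<eta>"
    using rare J(1) by blast
  from bchoice[OF this] obtain U where U: "\<And>y. y \<in> J \<Longrightarrow> open (U y) \<and> U y \<noteq> {}"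
    and U_rare: "\<And>y. y \<in> J \<Longrightarrow> upper_banach_density G (hitting_times G \<phi> m (U y) (V y)) \<le> ennreal \<eta>"
    by blast
  obtain W h where W: "open W" "W \<noteq> {}"
    and h: "\<And>y. y \<in> J \<Longrightarrow> h y \<in> carrier G \<and> \<phi> (h y) ` W \<subseteq> U y"
    using transitive_common_refinement[where U = U, OF trans J(2) U] by metis
  define S where "S = {g \<in> carrier G. Diam m (\<phi> g ` W) > ennreal a}"
  have "S \<subseteq> (\<Union>y\<in>J. hitting_times G \<phi> m W (V y))"
  proof
    fix g assume g: "g \<in> S"
    then obtain z where z: "z \<in> {1..m} \<rightarrow> \<phi> g ` W" "z \<in> K"
      unfolding S_def K_def by (auto elim: Diam_gt_imp_separated)
    then obtain y where y: "y \<in> J" "z \<in> B y" using J(3) by auto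
    have "\<phi> g ` W \<inter> V y k \<noteq> {}" if "k \<in> {1..m}" for k
      using z(1) y(2) that unfolding B_def by blast
    then have "g \<in> hitting_times G \<phi> m W (V y)"
      using g by (simp add: hitting_times_def S_def)
    then show "g \<in> (\<Union>y\<in>J. hitting_times G \<phi> m W (V y))"
      using y(1) by blast
  qed
  then have "indicator S g \<le> (\<Sum>y\<in>J. indicator (hitting_times G \<phi> m W (V y)) g :: ennreal)" for g
  proof (cases "g \<in> S")
    case True
    then obtain y where y: "y \<in> J" "g \<in> hitting_times G \<phi> m W (V y)"
      using \<open>S \<subseteq> _\<close> by auto
    have "indicator (hitting_times G \<phi> m W (V y)) g \<le>
        (\<Sum>y\<in>J. indicator (hitting_times G \<phi> m W (V y)) g :: ennreal)"
      using J(2) y(1) by (intro member_le_sum) auto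
    then show ?thesis using y True by simp
  qed simp
  then have "upper_banach_density G S \<le>
      upper_folner_mean G (\<lambda>g. \<Sum>y\<in>J. indicator (hitting_times G \<phi> m W (V y)) g)"
    unfolding upper_banach_density_eq_mean by (intro upper_folner_mean_mono)
  also have "\<dots> \<le> (\<Sum>y\<in>J. upper_banach_density G (hitting_times G \<phi> m W (V y)))"
    unfolding upper_banach_density_eq_mean using J(2) by (rule upper_folner_mean_sum)
  also have "\<dots> \<le> (\<Sum>y\<in>J. ennreal \<eta>)"
    using h by (intro sum_mono order_trans[OF density_hitting_times_le U_rare]) auto
  also have "\<dots> = ennreal (real (card J) * \<eta>)"
    using \<eta> by (simp add: ennreal_mult ennreal_of_nat_eq_real_of_nat)
  also have "\<dots> < ennreal c"
    using ac by (intro ennreal_lessI) (auto simp: \<eta>_def field_simps add_nonneg_pos)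
  finally show False using large[OF W] by (simp add: S_def)
qed

theorem theorem1p3:
  fixes G :: "('g, 'r) monoid_scheme"
    and \<phi> :: "'g \<Rightarrow> 'x::metric_space \<Rightarrow> 'x"
    and m :: nat
  assumes "topological_dynamical_system G \<phi>"
    and "transitive_tds G \<phi>"
    and "m \<ge> 1"
  shows "diam_mean_sensitive G \<phi> m \<longleftrightarrow>
    (\<exists>x :: nat \<Rightarrow> 'x. essential_tuple m x \<and> weakly_mean_sensitive_tuple G \<phi> m x)"
proof -
  interpret topological_dynamical_system G \<phi> by fact
  show ?thesis
    using essential_tuple_if_diam_mean_sensitive[OF assms(2) _ assms(3)]
      diam_mean_sensitive_if_essential_tuple by blast
qed

end
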